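(* Suppose that $s=(a,b,c,\theta)$ is a central configuration in $E$. Then $s$ is a co-circular central configuration (i.e. the four bodies $q_1,q_2,q_3,q_4$ lie on a common circle) if and only if $b=ac$.
   Context: Coordinates: a point $(a,b,c,\theta)$ with $a,b,c>0$ and $\theta\in(0,\pi)$ encodes the convex quadrilateral with consecutive vertices $q_1=(1,0)$, $q_2=(a\cos\theta,a\sin\theta)$, $q_3=(-b,0)$, $q_4=(-c\cos\theta,-c\sin\theta)$. With $r_{ij}=\|q_i-q_j\|$: $r_{12}^2=a^2-2a\cos\theta+1$, $r_{23}^2=a^2+2ab\cos\theta+b^2$, $r_{13}=b+1$, $r_{14}^2=c^2+2c\cos\theta+1$, $r_{34}^2=b^2-2bc\cos\theta+c^2$, $r_{24}=a+c$. Let $\mathcal C$ be the set of $(a,b,c,\theta)$ with $a,b,c>0$, $\theta\in(0,\pi)$ such that $r_{13}>r_{12}$, $r_{24}>r_{12}$, $r_{12}\ge r_{14}\ge r_{34}$ and $r_{12}\ge r_{23}\ge r_{34}$. Let $F(a,b,c,\theta)=(r_{24}^3-r_{14}^3)(r_{13}^3-r_{12}^3)(r_{23}^3-r_{34}^3)-(r_{12}^3-r_{14}^3)(r_{24}^3-r_{34}^3)(r_{13}^3-r_{23}^3)$, and $E=\{s\in\mathcal C: F(s)=0\}$. Points of $E$ correspond to the four-body convex central configurations with positive masses, up to isometry, rescaling and relabeling. *)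

theory Defs
  imports "HOL-Analysis.Analysis"
begin

text \<open>
  A quadruple \<open>(a, b, c, \<theta>)\<close> encodes the quadrilateral with consecutive vertices
  \<open>q1, q2, q3, q4\<close> below; its diagonals \<open>q1 q3\<close> and \<open>q2 q4\<close> meet at the origin at angle \<open>\<theta>\<close>.
\<close>

type_synonym config = "real \<times> real \<times> real \<times> real"

definition q1 :: "config \<Rightarrow> real ^ 2" where
  "q1 = (\<lambda>(a, b, c, \<theta>). vector [1, 0])"

definition q2 :: "config \<Rightarrow> real ^ 2" where
  "q2 = (\<lambda>(a, b, c, \<theta>). vector [a * cos \<theta>, a * sin \<theta>])"

definition q3 :: "config \<Rightarrow> real ^ 2" where
  "q3 = (\<lambda>(a, b, c, \<theta>). vector [- b, 0])"

definition q4 :: "config \<Rightarrow> real ^ 2" where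
  "q4 = (\<lambda>(a, b, c, \<theta>). vector [- c * cos \<theta>, - c * sin \<theta>])"

definition r12 :: "config \<Rightarrow> real" where "r12 s = norm (q1 s - q2 s)"
definition r13 :: "config \<Rightarrow> real" where "r13 s = norm (q1 s - q3 s)"
definition r14 :: "config \<Rightarrow> real" where "r14 s = norm (q1 s - q4 s)"
definition r23 :: "config \<Rightarrow> real" where "r23 s = norm (q2 s - q3 s)"
definition r24 :: "config \<Rightarrow> real" where "r24 s = norm (q2 s - q4 s)"
definition r34 :: "config \<Rightarrow> real" where "r34 s = norm (q3 s - q4 s)"

definition config_C :: "config set" where
  "config_C = {(a, b, c, \<theta>). let s = (a, b, c, \<theta>) in
     a > 0 \<and> b > 0 \<and> c > 0 \<and> 0 < \<theta> \<and> \<theta> < pi \<and>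
     r13 s > r12 s \<and> r24 s > r12 s \<and>
     r12 s \<ge> r14 s \<and> r14 s \<ge> r34 s \<and>
     r12 s \<ge> r23 s \<and> r23 s \<ge> r34 s}"

definition F :: "config \<Rightarrow> real" where
  "F s = (r24 s ^ 3 - r14 s ^ 3) * (r13 s ^ 3 - r12 s ^ 3) * (r23 s ^ 3 - r34 s ^ 3)
       - (r12 s ^ 3 - r14 s ^ 3) * (r24 s ^ 3 - r34 s ^ 3) * (r13 s ^ 3 - r23 s ^ 3)"

text \<open>
  The points of \<open>config_E\<close> correspond to the four-body convex central configurations with positive masses,
  up to isometry, rescaling and relabeling.
\<close>

definition config_E :: "config set" where
  "config_E = {s \<in> config_C. F s = 0}"

definition cocircular :: "config \<Rightarrow> bool" where
  "cocircular s \<longleftrightarrow> (\<exists>z \<rho>. \<rho> > 0 \<and> {q1 s, q2 s, q3 s, q4 s} \<subseteq> sphere z \<rho>)"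

lemma norm_vec2_sq: "norm (v :: real ^ 2) ^ 2 = (v $ 1)^2 + (v $ 2)^2"
  by (simp add: norm_vec_def L2_set_def sum_2)

lemma dist_sq_coords:
  "r12 (a, b, c, \<theta>) ^ 2 = a^2 - 2 * a * cos \<theta> + 1"
  "r23 (a, b, c, \<theta>) ^ 2 = a^2 + 2 * a * b * cos \<theta> + b^2"
  "r13 (a, b, c, \<theta>) ^ 2 = (b + 1)^2"
  "r14 (a, b, c, \<theta>) ^ 2 = c^2 + 2 * c * cos \<theta> + 1"
  "r34 (a, b, c, \<theta>) ^ 2 = b^2 - 2 * b * c * cos \<theta> + c^2"
  "r24 (a, b, c, \<theta>) ^ 2 = (a + c)^2"
  unfolding r12_def r23_def r13_def r14_def r34_def r24_def norm_vec2_sq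
    q1_def q2_def q3_def q4_def
  by (simp_all add: add.commute[of b 1], (use sin_cos_squared_add[of \<theta>] in algebra)+)

lemma r13_eq: "b > 0 \<Longrightarrow> r13 (a, b, c, \<theta>) = b + 1"
  by (rule power2_eq_imp_eq) (simp_all add: dist_sq_coords, simp add: r13_def)

lemma r24_eq: "a > 0 \<Longrightarrow> c > 0 \<Longrightarrow> r24 (a, b, c, \<theta>) = a + c"
  by (rule power2_eq_imp_eq) (simp_all add: dist_sq_coords, simp add: r24_def)

end

theory Submission
  imports Defs
begin

text \<open>
  The diagonals meet at the origin, so the theorem is the power of a point: the origin has power
  \<open>- b\<close> along the line \<open>q1 q3\<close> and \<open>- a * c\<close> along the line \<open>q2 q4\<close>.
\<close>

text \<open>Vieta's formulas: \<open>x *\<^sub>R u\<close> lies on the sphere exactly when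
  \<open>x\<close> is a root of the monic quadratic x^2 - 2 x (u \<bullet> z) + |z|^2 - \<rho>^2.
  For distinct \<open>s\<close> and \<open>t\<close>, both are roots iff their sum and product match
  its coefficients. The product condition is the power of the origin along the line.\<close>

lemma scaled_pair_in_sphere_iff:
  fixes u z :: "'a::real_inner"
  assumes "norm u = 1" "s \<noteq> t" "\<rho> > 0"
  shows "s *\<^sub>R u \<in> sphere z \<rho> \<and> t *\<^sub>R u \<in> sphere z \<rho> \<longleftrightarrow>
         u \<bullet> z = (s + t) / 2 \<and> \<rho>\<^sup>2 = (norm z)\<^sup>2 - s * t"
proof -
  have uu: "u \<bullet> u = 1"
    using assms(1) by (simp add: norm_eq_1)
  have mem: "x *\<^sub>R u \<in> sphere z \<rho> \<longleftrightarrow> x\<^sup>2 - 2 * x * (u \<bullet> z) + (norm z)\<^sup>2 = \<rho>\<^sup>2" for x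
  proof -
    have "(norm (z - x *\<^sub>R u))\<^sup>2 = x\<^sup>2 - 2 * x * (u \<bullet> z) + (norm z)\<^sup>2"
      unfolding power2_norm_eq_inner
      by (simp add: inner_diff_left inner_diff_right uu inner_commute[of z u]
          power2_eq_square algebra_simps)
    moreover have "x *\<^sub>R u \<in> sphere z \<rho> \<longleftrightarrow> (norm (z - x *\<^sub>R u))\<^sup>2 = \<rho>\<^sup>2"
      using assms(3) by (simp add: dist_norm)
    ultimately show ?thesis by simp
  qed
  show ?thesis unfolding mem
  proof
    assume h: "s\<^sup>2 - 2 * s * (u \<bullet> z) + (norm z)\<^sup>2 = \<rho>\<^sup>2 \<and> t\<^sup>2 - 2 * t * (u \<bullet> z) + (norm z)\<^sup>2 = \<rho>\<^sup>2"
    then have "(s - t) * (s + t - 2 * (u \<bullet> z)) = 0"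
      by (simp add: algebra_simps power2_eq_square)
    with assms(2) have "u \<bullet> z = (s + t) / 2" by simp
    with h show "u \<bullet> z = (s + t) / 2 \<and> \<rho>\<^sup>2 = (norm z)\<^sup>2 - s * t"
      by (simp add: field_simps power2_eq_square)
  qed (simp add: algebra_simps power2_eq_square)
qed

theorem theorem4p5:
  fixes a b c \<theta> :: real
  assumes "(a, b, c, \<theta>) \<in> config_E"
  shows "cocircular (a, b, c, \<theta>) \<longleftrightarrow> b = a * c"
proof -
  have pos: "a > 0" "b > 0" "c > 0" and "0 < \<theta>" "\<theta> < pi"
    using assms by (auto simp: config_E_def config_C_def Let_def)
  then have sin: "sin \<theta> \<noteq> 0"
    using sin_gt_zero by force
  \<comment> \<open>Unit directions of the two diagonals; each vertex is a signed multiple of one of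
    them.\<close>
  define e u :: "real ^ 2" where "e = vector [1, 0]" and "u = vector [cos \<theta>, sin \<theta>]"
  have norms: "norm e = 1" "norm u = 1"
    by (simp_all add: norm_eq_1 inner_vec_def sum_2 e_def u_def flip: power2_eq_square)
  have q: "q1 (a, b, c, \<theta>) = 1 *\<^sub>R e" "q3 (a, b, c, \<theta>) = (- b) *\<^sub>R e"
       "q2 (a, b, c, \<theta>) = a *\<^sub>R u" "q4 (a, b, c, \<theta>) = (- c) *\<^sub>R u"
    by (simp_all add: q1_def q2_def q3_def q4_def e_def u_def vec_eq_iff forall_2)
  have "cocircular (a, b, c, \<theta>) \<longleftrightarrow> (\<exists>z \<rho>. \<rho> > 0 \<and>
      (1 *\<^sub>R e \<in> sphere z \<rho> \<and> (- b) *\<^sub>R e \<in> sphere z \<rho>) \<and>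
      (a *\<^sub>R u \<in> sphere z \<rho> \<and> (- c) *\<^sub>R u \<in> sphere z \<rho>))"
    unfolding cocircular_def q by blast
  \<comment> \<open>Positivity separates \<open>1\<close> from \<open>- b\<close> and
    \<open>a\<close> from \<open>- c\<close>, so the lemma applies to each diagonal.\<close>
  also have "\<dots> \<longleftrightarrow> (\<exists>z \<rho>. \<rho> > 0 \<and>
      (e \<bullet> z = (1 - b) / 2 \<and> \<rho>\<^sup>2 = (norm z)\<^sup>2 + b) \<and>
      (u \<bullet> z = (a - c) / 2 \<and> \<rho>\<^sup>2 = (norm z)\<^sup>2 + a * c))"
    using pos scaled_pair_in_sphere_iff[OF norms(1), of 1 "- b"]
      scaled_pair_in_sphere_iff[OF norms(2), of a "- c"]
    by (intro ex_cong1 conj_cong[OF refl]) simp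
  also have "\<dots> \<longleftrightarrow> b = a * c"
  proof
    assume eq: "b = a * c"
    \<comment> \<open>The circumcenter: the intersection of the perpendicular bisectors of the
      diagonals. The first coordinate is read off from \<open>e\<close>; the second solves the
      equation for \<open>u\<close>, dividing by sin \<theta>.\<close>
    define z :: "real ^ 2" where
      "z = vector [(1 - b) / 2, ((a - c) / 2 - (1 - b) / 2 * cos \<theta>) / sin \<theta>]"
    have "e \<bullet> z = (1 - b) / 2" "u \<bullet> z = (a - c) / 2"
      using sin by (simp_all add: inner_vec_def sum_2 e_def u_def z_def)
    \<comment> \<open>This makes the square root below a legitimate radius.\<close>
    moreover have "(norm z)\<^sup>2 + b > 0"
      using pos by (simp add: add_nonneg_pos)
    ultimately show "\<exists>z \<rho>. \<rho> > 0 \<and>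
      (e \<bullet> z = (1 - b) / 2 \<and> \<rho>\<^sup>2 = (norm z)\<^sup>2 + b) \<and>
      (u \<bullet> z = (a - c) / 2 \<and> \<rho>\<^sup>2 = (norm z)\<^sup>2 + a * c)"
      using eq by (intro exI[of _ z] exI[of _ "sqrt ((norm z)\<^sup>2 + b)"]) simp
  \<comment> \<open>The remaining direction equates the two expressions for \<rho>^2.\<close>
  qed auto
  finally show ?thesis .
qed

end
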